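(* Let $H$ be a triangle-free $2$-connected cubic graph with $n \geq 8$ vertices, and let $G$ be obtained from $H$ by bridging a pair of edges of $H$ with cycle spread at least $(1,1)$. Then at least one of the following holds: (i) $H \cong Q_{2k}$ and $G \cong Q_{2(k+1)}$ for some $k \geq 4$; (ii) $H \cong V_{2k}$ and $G \cong V_{2(k+1)}$ for some $k \geq 4$; (iii) $G$ is (isomorphic to a graph) obtained from $H$ by bridging a pair of edges of $H$ with cycle spread at least $(1,2)$.
   Context: Graphs are finite and simple. A cubic graph is one in which every vertex has degree $3$. A triangle-free graph has no cycle of length $3$. Bridging: given two distinct edges $ab$ and $cd$ of a graph, subdivide $ab$ by a new vertex $x$ (replacing $ab$ by the path $a x b$) and $cd$ by a new vertex $y$ (replacing $cd$ by $c y d$), and add the edge $xy$. The resulting graph (with new edges $xa, xb, yc, yd, xy$) is said to be obtained by bridging the pair $ab, cd$. Cycle spread: let $ab$ and $cd$ be two edges of a $2$-connected graph and let $C$ be a smallest cycle containing both. Removing the two edges from $C$ leaves two paths joining them; labelling so that these paths join $a$ to $c$ and $b$ to $d$ and the $a$–$c$ path is no longer than the $b$–$d$ path, the cycle spread of $ab, cd$ is the pair $(i,j)$, $i \le j$, of the lengths of these two paths (by convention an edge with itself has cycle spread $(0,0)$). Pairs are compared lexicographically. Thus two edges have cycle spread at least $(1,1)$ exactly when they are distinct and non-adjacent (share no end vertex), and cycle spread at least $(1,2)$ exactly when they are non-adjacent and there is no $4$-cycle containing both of them. $Q_{2k}$ (the ladder, $k\ge 4$) is the graph on $2k$ vertices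 consisting of two $k$-cycles $u_1u_2\cdots u_k u_1$ and $v_1 v_2\cdots v_k v_1$ together with the edges $u_iv_i$, $1\le i\le k$ (so $Q_8$ is the cube). $V_{2k}$ (the Möbius ladder) is the graph obtained from a $2k$-cycle $w_0w_1\cdots w_{2k-1}w_0$ by adding the edges $w_iw_{i+k}$ for $0\le i\le k-1$. *)

theory Defs
  imports "Graph_Theory.Graph_Theory"
begin

text \<open>
  Finite simple graphs are the structures satisfying \<^const>\<open>pair_graph\<close>: an undirected edge is
  represented by its two opposite arcs, and an edge argument \<open>e\<close> below is either one of them.
\<close>

definition same_edge :: "'a \<times> 'a \<Rightarrow> 'a \<times> 'a \<Rightarrow> bool" where
  "same_edge e f \<longleftrightarrow> f = e \<or> f = prod.swap e"

definition cubic :: "'a pair_pre_digraph \<Rightarrow> bool" where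
  "cubic G \<longleftrightarrow> (\<forall>v\<in>pverts G. out_degree (with_proj G) v = 3)"

text \<open>
  The library's \<open>cycle\<close> is directed and admits \<open>u, v, u\<close> in a symmetric digraph; requiring
  length at least 3 leaves exactly the undirected cycles, each with a starting point and a direction.
\<close>

definition ucycle :: "'a pair_pre_digraph \<Rightarrow> ('a \<times> 'a) list \<Rightarrow> bool" where
  "ucycle G p \<longleftrightarrow> pre_digraph.cycle (with_proj G) p \<and> 3 \<le> length p"

definition triangle_free :: "'a pair_pre_digraph \<Rightarrow> bool" where
  "triangle_free G \<longleftrightarrow> \<not> (\<exists>p. ucycle G p \<and> length p = 3)"

definition two_connected :: "'a pair_pre_digraph \<Rightarrow> bool" where
  "two_connected G \<longleftrightarrow> 3 \<le> card (pverts G) \<and> connected (with_proj G) \<and>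
     (\<forall>v\<in>pverts G. connected (pre_digraph.del_vert (with_proj G) v))"

definition graph_iso :: "'a pair_pre_digraph \<Rightarrow> 'b pair_pre_digraph \<Rightarrow> bool" where
  "graph_iso G H \<longleftrightarrow> digraph_iso (with_proj G) (with_proj H)"

definition bridge ::
  "'a pair_pre_digraph \<Rightarrow> 'a \<times> 'a \<Rightarrow> 'a \<times> 'a \<Rightarrow> 'a \<Rightarrow> 'a \<Rightarrow> 'a pair_pre_digraph" where
  "bridge H e f x y =
     (let S = subdivide (subdivide H e x) f y
      in \<lparr>pverts = pverts S, parcs = parcs S \<union> {(x, y), (y, x)}\<rparr>)"

definition bridging ::
  "'a pair_pre_digraph \<Rightarrow> 'a \<times> 'a \<Rightarrow> 'a \<times> 'a \<Rightarrow> 'a pair_pre_digraph \<Rightarrow> bool" where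
  "bridging H e f G \<longleftrightarrow>
     e \<in> parcs H \<and> f \<in> parcs H \<and> \<not> same_edge e f \<and>
     (\<exists>x y. x \<notin> pverts H \<and> y \<notin> pverts H \<and> x \<noteq> y \<and> G = bridge H e f x y)"

definition cycle_through ::
  "'a pair_pre_digraph \<Rightarrow> 'a \<times> 'a \<Rightarrow> 'a \<times> 'a \<Rightarrow> ('a \<times> 'a) list \<Rightarrow> bool" where
  "cycle_through G e f p \<longleftrightarrow>
     ucycle G p \<and> (\<exists>e'\<in>set p. same_edge e e') \<and> (\<exists>f'\<in>set p. same_edge f f')"

text \<open>
  In the second case the cycle is started at the arc \<open>(b, a)\<close> of the edge \<open>ab\<close> and runs
  through \<open>(c, d)\<close>; removing these two arcs leaves the path \<open>P\<close> from \<open>a\<close> to \<open>c\<close> and the path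
  \<open>Q\<close> from \<open>d\<close> to \<open>b\<close>. The cycle spread is a relation because two edges may lie on several
  smallest cycles, which may split differently. Whether the spread is at least \<open>(1, 1)\<close>, or at
  least \<open>(1, 2)\<close>, does not depend on the choice: two edges of a cycle that share an end are
  consecutive on it, so \<open>i = 0\<close> exactly for adjacent or equal edges, and \<open>i + j + 2\<close> is the same
  for all smallest cycles.
\<close>

definition cycle_spread ::
  "'a pair_pre_digraph \<Rightarrow> 'a \<times> 'a \<Rightarrow> 'a \<times> 'a \<Rightarrow> nat \<times> nat \<Rightarrow> bool" where
  "cycle_spread G e f s \<longleftrightarrow>
     (if same_edge e f then s = (0, 0)
      else \<exists>a b c d P Q.
        same_edge e (b, a) \<and> same_edge f (c, d) \<and>
        is_arg_min length (cycle_through G e f) ((b, a) # P @ (c, d) # Q) \<and>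
        length P \<le> length Q \<and> s = (length P, length Q))"

definition cycle_spread_at_least ::
  "'a pair_pre_digraph \<Rightarrow> 'a \<times> 'a \<Rightarrow> 'a \<times> 'a \<Rightarrow> nat \<times> nat \<Rightarrow> bool" where
  "cycle_spread_at_least G e f t \<longleftrightarrow>
     (\<exists>s. cycle_spread G e f s \<and> (t = s \<or> (t, s) \<in> less_than <*lex*> less_than))"

text \<open>\<open>ladder k\<close> is $Q_{2k}$, with \<open>(i, False)\<close> for $u_{i+1}$ and \<open>(i, True)\<close> for $v_{i+1}$;
  \<open>moebius_ladder k\<close> is $V_{2k}$. The index is half the number of vertices.\<close>

definition ladder :: "nat \<Rightarrow> (nat \<times> bool) pair_pre_digraph" where
  "ladder k =
     (let R = {((i, s), ((i + 1) mod k, s)) | i s. i < k} \<union> {((i, False), (i, True)) | i. i < k}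
      in \<lparr>pverts = {..<k} \<times> UNIV, parcs = R \<union> R\<inverse>\<rparr>)"

definition moebius_ladder :: "nat \<Rightarrow> nat pair_pre_digraph" where
  "moebius_ladder k =
     (let R = {(i, (i + 1) mod (2 * k)) | i. i < 2 * k} \<union> {(i, i + k) | i. i < k}
      in \<lparr>pverts = {..<2 * k}, parcs = R \<union> R\<inverse>\<rparr>)"

end

theory Submission
  imports Defs "HOL-Combinatorics.Transposition"
begin

text \<open>
  If the spread is exactly \<open>(1, 1)\<close>, the two edges are opposite in a 4-cycle, that is, they are the
  rails of a ladder with two rungs, and bridging them inserts a third rung \<open>xy\<close>. The new rung can
  be exchanged with the last rung of the ladder, so \<open>G\<close> also arises by bridging the next pair of
  rails \<open>p p'\<close>, \<open>q q'\<close> beyond that rung \<open>pq\<close>. If \<open>p'\<close> and \<open>q'\<close> are not adjacent, this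
  pair has spread at least \<open>(1, 2)\<close>. If they are adjacent and new, the ladder has become longer and
  the argument is repeated. Otherwise they are the two ends of the first rung; the ladder closes up,
  straight or twisted, and by connectedness \<open>H\<close> is a ladder or a Moebius ladder, with \<open>G\<close>
  the next larger one.
\<close>

section \<open>Graph isomorphisms as vertex maps\<close>

text \<open>An arc of a pair digraph is the pair of its ends, so the vertex map of a library
  isomorphism determines its arc map, and the tail and head functions of the image can only be
  \<open>fst\<close> and \<open>snd\<close>.\<close>

lemma graph_iso_iff:
  "graph_iso A B \<longleftrightarrow> pair_wf_digraph A \<and>
     (\<exists>h. inj_on h (pverts A) \<and> pverts B = h ` pverts A \<and> parcs B = map_prod h h ` parcs A)"
    (is "_ \<longleftrightarrow> _ \<and> (\<exists>h. ?P h)")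
proof
  assume "graph_iso A B"
  then obtain f where f: "pre_digraph.digraph_isomorphism (with_proj A) f"
    and B: "with_proj B = app_iso f (with_proj A)"
    unfolding graph_iso_def digraph_iso_def by blast
  have wf: "pair_wf_digraph A" and inj: "inj_on (iso_verts f) (pverts A)"
    and ends: "\<And>a. a \<in> parcs A \<Longrightarrow> iso_verts f (fst a) = iso_tail f (iso_arcs f a) \<and>
      iso_verts f (snd a) = iso_head f (iso_arcs f a)"
    using f unfolding pre_digraph.digraph_isomorphism_def wf_digraph_wp_iff by auto
  have "pverts B = iso_verts f ` pverts A" "parcs B = iso_arcs f ` parcs A"
    "iso_tail f = fst" "iso_head f = snd"
    using arg_cong[OF B, of verts] arg_cong[OF B, of arcs]
      arg_cong[OF B, of tail] arg_cong[OF B, of head] by simp_all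
  moreover have "iso_arcs f a = map_prod (iso_verts f) (iso_verts f) a" if "a \<in> parcs A" for a
    using ends[OF that] calculation(3,4) by (auto intro: prod_eqI)
  ultimately have "?P (iso_verts f)" using inj by auto
  with wf show "pair_wf_digraph A \<and> (\<exists>h. ?P h)" by blast
next
  assume "pair_wf_digraph A \<and> (\<exists>h. ?P h)"
  then obtain h where wf: "pair_wf_digraph A" and h: "?P h" by blast
  interpret A: pair_wf_digraph A by fact
  define f where
    "f = \<lparr>iso_verts = h, iso_arcs = map_prod h h, iso_head = snd, iso_tail = fst\<rparr>"
  have "inj_on (map_prod h h) (parcs A)"
  proof (rule inj_on_subset)
    show "inj_on (map_prod h h) (pverts A \<times> pverts A)" using h by (auto intro: map_prod_inj_on)
    show "parcs A \<subseteq> pverts A \<times> pverts A" using A.wellformed' by auto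
  qed
  then have "A.digraph_isomorphism f"
    using h wf unfolding A.digraph_isomorphism_def wf_digraph_wp_iff by (auto simp: f_def)
  moreover have "with_proj B = app_iso f (with_proj A)"
    using h by (auto simp: with_proj_def app_iso_def f_def)
  ultimately show "graph_iso A B" unfolding graph_iso_def digraph_iso_def by blast
qed

lemma graph_isoI:
  assumes "pair_wf_digraph A" "inj_on h (pverts A)" "pverts B = h ` pverts A"
    "parcs B = map_prod h h ` parcs A"
  shows "graph_iso A B"
  unfolding graph_iso_iff using assms by (intro conjI exI[of _ h])

lemma graph_isoE:
  assumes "graph_iso A B"
  obtains h where "pair_wf_digraph A" "inj_on h (pverts A)" "pverts B = h ` pverts A"
    "parcs B = map_prod h h ` parcs A"
  using assms unfolding graph_iso_iff by (elim conjE exE) (rule that)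

lemma graph_iso_refl: "pair_wf_digraph A \<Longrightarrow> graph_iso A A"
  by (rule graph_isoI[of _ id]) (auto simp: prod.map_id0)

lemma graph_iso_trans:
  assumes "graph_iso A B" "graph_iso B C"
  shows "graph_iso A C"
proof -
  from assms(1) obtain g where "pair_wf_digraph A" and g: "inj_on g (pverts A)"
      "pverts B = g ` pverts A" "parcs B = map_prod g g ` parcs A"
    by (rule graph_isoE)
  moreover from assms(2) obtain h where h: "inj_on h (pverts B)"
      "pverts C = h ` pverts B" "parcs C = map_prod h h ` parcs B"
    by (rule graph_isoE)
  ultimately show ?thesis
    by (intro graph_isoI[of _ "h \<circ> g"])
      (simp_all add: comp_inj_on image_comp map_prod.comp)
qed

lemma graph_iso_sym:
  assumes "graph_iso A B"
  shows "graph_iso B A"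
proof -
  from assms obtain h where wf: "pair_wf_digraph A" and h: "inj_on h (pverts A)"
      "pverts B = h ` pverts A" "parcs B = map_prod h h ` parcs A"
    by (rule graph_isoE)
  interpret A: pair_wf_digraph A by fact
  let ?g = "the_inv_into (pverts A) h"
  have gh: "?g (h v) = v" if "v \<in> pverts A" for v using h(1) that by (rule the_inv_into_f_f)
  show ?thesis
  proof (rule graph_isoI[of _ ?g])
    show "pair_wf_digraph B"
      by unfold_locales (use A.wellformed' in \<open>auto simp: h(2,3)\<close>)
    show "inj_on ?g (pverts B)" unfolding h(2) by (rule inj_on_the_inv_into) (rule h(1))
    show "pverts A = ?g ` pverts B" by (auto simp: h(2) gh image_image)
    \<comment> \<open>\<open>?g\<close> inverts \<open>h\<close> on vertices only; this suffices
      because the ends of every arc are vertices.\<close>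
    have "map_prod ?g ?g (map_prod h h a) = a" if "a \<in> parcs A" for a
      using that A.wellformed' by (cases a) (auto simp: gh)
    then show "parcs A = map_prod ?g ?g ` parcs B" by (simp add: h(3) image_image)
  qed
qed

section \<open>Undirected cycles and the cycle spread\<close>

lemma same_edge_swap: "same_edge e (prod.swap f) \<longleftrightarrow> same_edge e f"
  by (cases e; cases f) (auto simp: same_edge_def)

lemma pcas_append: "pcas u (p @ q) w \<longleftrightarrow> (\<exists>v. pcas u p v \<and> pcas v q w)"
  by (induction p arbitrary: u) auto

lemma pcas_verts: "pcas u p v \<Longrightarrow> pawalk_verts u p = u # map snd p"
  by (induction p arbitrary: u) auto

lemma pcas_ends: "pcas u p v \<Longrightarrow> map fst p @ [v] = u # map snd p"
  by (induction p arbitrary: u) auto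

text \<open>Cancelling the common end in \<open>pcas_ends\<close> shows that tails and heads of a
  closed walk form the same multiset. Reversing a cycle turns its heads into tails, so this keeps it
  a cycle.\<close>

lemma pcas_closed_distinct:
  assumes "pcas u p u"
  shows "distinct (map fst p) \<longleftrightarrow> distinct (map snd p)"
proof -
  have "mset (map fst p @ [u]) = mset (u # map snd p)" using pcas_ends[OF assms] by simp
  then have "mset (map fst p) = mset (map snd p)" by simp
  then show ?thesis by (rule mset_eq_imp_distinct_iff)
qed

lemma rev_path_eq_rev_map: "rev_path p = rev (map prod.swap p)"
  by (induction p) (auto simp: prod.swap_def)

lemma length_rev_path [simp]: "length (rev_path p) = length p"
  by (simp add: rev_path_eq_rev_map)

lemma pcas_rev_path: "pcas u p v \<Longrightarrow> pcas v (rev_path p) u"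
  by (induction p arbitrary: u) (auto simp: pcas_append)

context pair_graph
begin

text \<open>With at least 3 arcs, all in the graph, the walk is nonempty and starts at a vertex; its
  vertex list without the first entry is the list of heads.\<close>

lemma ucycle_iff:
  "ucycle G p \<longleftrightarrow>
     set p \<subseteq> parcs G \<and> (\<exists>u. pcas u p u) \<and> distinct (map snd p) \<and> 3 \<le> length p"
proof -
  have "u \<in> pverts G" if "set p \<subseteq> parcs G" "pcas u p u" "3 \<le> length p" for u
    using that in_arcsD1 by (cases p) auto
  moreover have "pawalk_verts u p = u # map snd p" if "pcas u p u" for u
    using that by (rule pcas_verts)
  moreover have "p \<noteq> []" if "3 \<le> length p" using that by auto
  ultimately show ?thesis
    unfolding ucycle_def cycle_def awalk_def by (metis list.sel(3))
qed

lemma ucycle_rotate: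
  assumes "ucycle G (p @ q)"
  shows "ucycle G (q @ p)"
proof -
  obtain u v where "pcas u p v" "pcas v q u"
    using assms pcas_append unfolding ucycle_iff by metis
  then have "pcas v (q @ p) v" using pcas_append by metis
  then show ?thesis using assms unfolding ucycle_iff by auto
qed

lemma ucycle_rev_path: "ucycle G p \<Longrightarrow> ucycle G (rev_path p)"
proof -
  assume p: "ucycle G p"
  then obtain u where u: "pcas u p u" unfolding ucycle_iff by blast
  have "map snd (rev_path p) = rev (map fst p)" by (simp add: rev_path_eq_rev_map rev_map)
  then have "distinct (map snd (rev_path p))"
    using p pcas_closed_distinct[OF u] unfolding ucycle_iff by simp
  moreover have "set (rev_path p) \<subseteq> parcs G"
    using p arcs_symmetric unfolding ucycle_iff by (auto simp: rev_path_eq_rev_map)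
  ultimately show ?thesis
    using p pcas_rev_path[OF u] unfolding ucycle_iff by auto
qed

text \<open>Rotation and reversal bring a smallest cycle into the shape that
  \<open>cycle_spread\<close> prescribes.\<close>

lemma cycle_through_rotate: "cycle_through G e f (p @ q) \<Longrightarrow> cycle_through G e f (q @ p)"
  using ucycle_rotate unfolding cycle_through_def by auto

lemma cycle_through_rev_path: "cycle_through G e f p \<Longrightarrow> cycle_through G e f (rev_path p)"
proof -
  have "(\<exists>e'\<in>set (rev_path p). same_edge g e') \<longleftrightarrow> (\<exists>e'\<in>set p. same_edge g e')" for g
    by (simp add: rev_path_eq_rev_map same_edge_swap del: swap_simp)
  then show "cycle_through G e f p \<Longrightarrow> cycle_through G e f (rev_path p)"
    using ucycle_rev_path unfolding cycle_through_def by simp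
qed

lemma ucycle_Cons_ConsD:
  assumes "ucycle G ((b, a) # P @ (c, d) # Q)"
  shows "pcas a P c" "pcas d Q b"
  using assms unfolding ucycle_iff by (auto simp: pcas_append)

lemma triangle_freeD:
  assumes "triangle_free G" "(a, b) \<in> parcs G" "(b, c) \<in> parcs G" "(c, a) \<in> parcs G"
  shows False
proof -
  have "a \<noteq> b" "b \<noteq> c" "c \<noteq> a" using assms(2-4) no_loops' by auto
  then have "ucycle G [(a, b), (b, c), (c, a)]" using assms unfolding ucycle_iff by auto
  then show False using assms(1) unfolding triangle_free_def by force
qed

text \<open>Once some cycle contains both edges, a smallest one exists. Disjoint ends rule out an
  empty connecting path, and \<open>no4\<close> rules out that both connecting paths are single
  arcs; every other pair of lengths is at least \<open>(1, 2)\<close>.\<close>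

lemma cycle_spread_at_least_1_2:
  assumes "cycle_through G e f p" "{fst e, snd e} \<inter> {fst f, snd f} = {}"
    and no4: "\<And>a b c d. \<lbrakk>same_edge e (b, a); same_edge f (c, d);
                (a, c) \<in> parcs G; (d, b) \<in> parcs G\<rbrakk> \<Longrightarrow> False"
  shows "cycle_spread_at_least G e f (1, 2)"
proof -
  let ?min = "is_arg_min length (cycle_through G e f)"
  have same_length: "?min q" if "?min p" "cycle_through G e f q" "length q = length p" for p q
    using that by (auto simp: is_arg_min_def)
  have "\<not> same_edge e f" using assms(2) by (auto simp: same_edge_def)
  obtain p where p: "?min p"
    using assms(1) ex_has_least_nat[of "cycle_through G e f" p length]
    by (auto simp: is_arg_min_linorder)
  then have pc: "cycle_through G e f p" by (auto simp: is_arg_min_def)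
  then obtain e' f' where e': "e' \<in> set p" "same_edge e e'" and f': "f' \<in> set p" "same_edge f f'"
    unfolding cycle_through_def by blast
  obtain p1 p2 where p12: "p = p1 @ e' # p2" using e'(1) by (meson split_list)
  have "e' \<noteq> f'"
    using e'(2) f'(2) assms(2) by (cases e; cases f) (auto simp: same_edge_def)
  then have "f' \<in> set (p2 @ p1)" using f'(1) p12 by auto
  then obtain P Q where PQ: "p2 @ p1 = P @ f' # Q" by (meson split_list)
  \<comment> \<open>Rotating \<open>p\<close> makes it start at \<open>e'\<close> without changing
    its length, so it stays a smallest cycle.\<close>
  have c: "cycle_through G e f (e' # P @ f' # Q)"
    using cycle_through_rotate[of e f p1 "e' # p2"] pc p12 PQ by auto
  have "length (p2 @ p1) = length (P @ f' # Q)" using PQ by simp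
  then have len: "length (e' # P @ f' # Q) = length p" using p12 by simp
  obtain e' f' P Q where e': "same_edge e e'" and f': "same_edge f f'"
    and m: "?min (e' # P @ f' # Q)" and le: "length P \<le> length Q"
  proof (cases "length P \<le> length Q")
    case True
    show ?thesis by (rule that[OF e'(2) f'(2) same_length[OF p c len] True])
  next
    case False
    let ?e = "prod.swap e'" and ?f = "prod.swap f'"
    \<comment> \<open>Reversal leaves the swapped \<open>e'\<close> at the end; one rotation brings
      it to the front, and the two connecting paths have changed places.\<close>
    have "rev_path (e' # P @ f' # Q) = (rev_path Q @ ?f # rev_path P) @ [?e]"
      by (simp add: prod.swap_def)
    then have "cycle_through G e f ([?e] @ rev_path Q @ ?f # rev_path P)"
      using cycle_through_rotate cycle_through_rev_path[OF c] by metis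
    then have c': "cycle_through G e f (?e # rev_path Q @ ?f # rev_path P)" by simp
    show ?thesis
    proof (rule that)
      show "?min (?e # rev_path Q @ ?f # rev_path P)"
        using same_length[OF p c'] len by simp
    qed (use False e'(2) f'(2) in \<open>auto simp: same_edge_swap\<close>)
  qed
  obtain a b c d where ef: "e' = (b, a)" "f' = (c, d)" by fastforce
  have u: "ucycle G ((b, a) # P @ (c, d) # Q)"
    using m ef by (auto simp: is_arg_min_def cycle_through_def)
  \<comment> \<open>An empty \<open>P\<close> would give \<open>a = c\<close>, a common end of the
    two edges.\<close>
  have "P \<noteq> []" 
    using ucycle_Cons_ConsD(1)[OF u] assms(2) e' f' ef
    by (cases e; cases f) (auto simp: same_edge_def)
  moreover have False if "length P = 1" "length Q = 1"
  proof -
    have "P = [hd P]" "Q = [hd Q]" using that by (auto simp: length_Suc_conv)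
    then have "P = [(a, c)]" "Q = [(d, b)]"
      using ucycle_Cons_ConsD[OF u] by (metis pcas.simps prod.collapse)+
    then have "(a, c) \<in> parcs G" "(d, b) \<in> parcs G"
      using u unfolding ucycle_iff by simp_all
    then show False using no4 e' f' ef by blast
  qed
  ultimately have "(1, 2) = (length P, length Q) \<or>
      ((1, 2), (length P, length Q)) \<in> less_than <*lex*> less_than"
    using le unfolding in_lex_prod less_than_iff prod.inject length_0_conv[symmetric] by presburger
  moreover have "cycle_spread G e f (length P, length Q)"
    unfolding cycle_spread_def if_not_P[OF \<open>\<not> same_edge e f\<close>]
    by (intro exI conjI) (use e' f' m le ef in auto)
  ultimately show ?thesis
    unfolding cycle_spread_at_least_def by (intro exI[of _ "(length P, length Q)"] conjI)
qed

end

section \<open>Connectivity of cubic graphs\<close>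

context pair_graph
begin

lemma card_neighbours:
  assumes "cubic G" "v \<in> pverts G"
  shows "card (parcs G `` {v}) = 3"
proof -
  have "out_arcs (with_proj G) v = Pair v ` (parcs G `` {v})"
    by (force simp: out_arcs_def)
  then have "out_degree (with_proj G) v = card (parcs G `` {v})"
    unfolding out_degree_def by (simp add: card_image inj_on_def)
  then show ?thesis using assms unfolding cubic_def by simp
qed

lemma finite_neighbours: "finite (parcs G `` {v})"
  using pair_finite_arcs by (rule finite_Image)

lemma neighbours_eq:
  assumes "cubic G" "(v, a) \<in> parcs G" "(v, b) \<in> parcs G" "(v, c) \<in> parcs G"
    "a \<noteq> b" "b \<noteq> c" "a \<noteq> c"
  shows "parcs G `` {v} = {a, b, c}"
proof -
  have "v \<in> pverts G" using assms(2) by (rule in_arcsD1)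
  then have "card {a, b, c} = card (parcs G `` {v})"
    using assms card_neighbours by simp
  moreover have "{a, b, c} \<subseteq> parcs G `` {v}" using assms by auto
  ultimately show ?thesis using card_subset_eq[OF finite_neighbours] by metis
qed

lemma third_neighbour:
  assumes "cubic G" "(v, a) \<in> parcs G" "(v, b) \<in> parcs G" "a \<noteq> b"
  obtains c where "parcs G `` {v} = {a, b, c}" "c \<noteq> a" "c \<noteq> b" "(v, c) \<in> parcs G"
proof -
  have "v \<in> pverts G" using assms(2) by (rule in_arcsD1)
  then have "card (parcs G `` {v}) = 3" using assms(1) by (intro card_neighbours)
  then have "\<not> parcs G `` {v} \<subseteq> {a, b}"
    using card_mono[of "{a, b}" "parcs G `` {v}"] assms(4) by auto
  then obtain c where c: "(v, c) \<in> parcs G" "c \<noteq> a" "c \<noteq> b" by auto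
  with assms have "parcs G `` {v} = {a, b, c}" by (intro neighbours_eq) auto
  with c show ?thesis by (intro that)
qed

lemma connected_closed_set:
  assumes "connected (with_proj G)" "S \<subseteq> pverts G" "S \<noteq> {}"
    and closed: "\<And>u v. u \<in> S \<Longrightarrow> (u, v) \<in> parcs G \<Longrightarrow> v \<in> S"
  shows "S = pverts G"
proof
  obtain u where u: "u \<in> S" using assms(3) by blast
  show "pverts G \<subseteq> S"
  proof
    fix v assume "v \<in> pverts G"
    then have "(u, v) \<in> rtrancl_on (pverts G) (symcl (parcs G))"
      using assms(1,2) u unfolding connected_conv by auto
    then show "v \<in> S"
    proof (induction rule: rtrancl_on_induct)
      case base
      show ?case by (rule u)
    next
      case (step y z)
      then have "(y, z) \<in> parcs G" using arcs_symmetric by (auto simp: symcl_def)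
      then show ?case using closed step by blast
    qed
  qed
qed (use assms in blast)

text \<open>Follow a walk from \<open>u\<close> to \<open>q\<close> that avoids \<open>p\<close> up
  to its first visit to \<open>q\<close>; \<open>w\<close> is the vertex just before.\<close>

lemma reach_neighbour_avoiding:
  assumes "connected (del_vert p)" "u \<in> pverts G" "u \<noteq> p" "u \<noteq> q" "q \<in> pverts G" "q \<noteq> p"
  obtains w where "(w, q) \<in> parcs G" "w \<noteq> p"
    "(u, w) \<in> (parcs G \<inter> (- {p, q}) \<times> (- {p, q}))\<^sup>*"
proof -
  let ?E = "parcs G \<inter> (- {p, q}) \<times> (- {p, q})"
  \<comment> \<open>Invariant along the walk: either \<open>q\<close> has not been met so far, or a
    suitable \<open>w\<close> was found at its first visit.\<close>
  let ?P = "\<lambda>v. (v \<noteq> q \<and> (u, v) \<in> ?E\<^sup>*) \<or>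
    (\<exists>w. (w, q) \<in> parcs G \<and> w \<noteq> p \<and> (u, w) \<in> ?E\<^sup>*)"
  have ends: "arcs_ends (del_vert p) = {(a, b) \<in> parcs G. a \<noteq> p \<and> b \<noteq> p}"
    by (auto simp: arcs_ends_conv del_vert_simps)
  have "(u, q) \<in> rtrancl_on (pverts G - {p}) (symcl (arcs_ends (del_vert p)))"
    using assms unfolding connected_conv by (auto simp: del_vert_simps)
  then have "?P q"
  proof (induction rule: rtrancl_on_induct[where P = ?P])
    case base
    then show ?case using assms by simp
  next
    case (step y z)
    then have yz: "(y, z) \<in> parcs G" "y \<noteq> p" "z \<noteq> p"
      using arcs_symmetric by (auto simp: symcl_def ends)
    show ?case
    proof (cases "y \<noteq> q \<and> (u, y) \<in> ?E\<^sup>*")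
      case True
      show ?thesis
      proof (cases "z = q")
        case True
        then show ?thesis using yz \<open>y \<noteq> q \<and> (u, y) \<in> ?E\<^sup>*\<close> by blast
      next
        case False
        then have "(y, z) \<in> ?E" using yz True by simp
        then show ?thesis using True False by (meson rtrancl.rtrancl_into_rtrancl)
      qed
    next
      case False
      then show ?thesis using step.IH by blast
    qed
  qed
  then show ?thesis using that by blast
qed

lemma distinct_path_avoiding:
  assumes "(u, v) \<in> (parcs G \<inter> (- S) \<times> (- S))\<^sup>*"
  obtains r where "pcas u r v" "set r \<subseteq> parcs G \<inter> (- S) \<times> (- S)" "distinct (u # map snd r)"
proof -
  let ?E = "parcs G \<inter> (- S) \<times> (- S)"
  \<comment> \<open>The arcs outside \<open>S\<close> form a digraph of their own, so that
    shortening a walk to a path cannot lead back into \<open>S\<close>. Adding \<open>u\<close>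
    makes the empty walk legal in every case.\<close>
  define K where "K = \<lparr>pverts = insert u (pverts G), parcs = ?E\<rparr>"
  interpret K: pair_wf_digraph K
    by unfold_locales (use wellformed' in \<open>auto simp: K_def\<close>)
  have "K.awalk u [] u" unfolding K.awalk_Nil_iff by (simp add: K_def)
  from assms have "\<exists>p. K.awalk u p v"
  proof (induction rule: rtrancl_induct)
    case base
    show ?case using \<open>K.awalk u [] u\<close> by blast
  next
    case (step y z)
    then obtain p where "K.awalk u p y" by blast
    moreover have "K.awalk y [(y, z)] z"
      using step(2) K.arc_implies_awalk[of "(y, z)"] by (auto simp: K_def)
    ultimately show ?case using K.awalk_appendI by blast
  qed
  then obtain r where "K.apath u r v" using K.apath_awalk_to_apath by blast
  then have r: "pcas u r v" "set r \<subseteq> ?E" "distinct (pawalk_verts u r)"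
    unfolding K.apath_def K.awalk_def by (auto simp: K_def)
  from r(3) have "distinct (u # map snd r)" unfolding pcas_verts[OF r(1)] .
  with r show ?thesis by (intro that)
qed

text \<open>
  A path from \<open>p'\<close> to \<open>q'\<close> avoiding the rung \<open>pq\<close> closes up to the required cycle. If deleting
  \<open>p\<close> leaves \<open>p'\<close> joined to \<open>q\<close> only through \<open>q\<^sub>0\<close>, and deleting \<open>q\<close> leaves \<open>q'\<close> joined to
  \<open>p\<close> only through \<open>p\<^sub>0\<close>, then the previous rung \<open>p\<^sub>0q\<^sub>0\<close> supplies that path.
\<close>
lemma cycle_through_ladder_end:
  assumes conn: "connected (del_vert p)" "connected (del_vert q)"
    and p: "parcs G `` {p} = {p\<^sub>0, q, p'}" and q: "parcs G `` {q} = {q\<^sub>0, p, q'}"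
    and "(p\<^sub>0, q\<^sub>0) \<in> parcs G" and d: "distinct [p\<^sub>0, q\<^sub>0, p, q, p', q']"
  obtains r where "cycle_through G (p, p') (q, q') r"
proof -
  let ?E = "parcs G \<inter> (- {p, q}) \<times> (- {p, q})"
  have arcs: "(p, p') \<in> parcs G" "(q, q') \<in> parcs G" "(p, q) \<in> parcs G" using p q by auto
  have sym: "(v, u) \<in> ?E\<^sup>*" if "(u, v) \<in> ?E\<^sup>*" for u v
  proof -
    have "sym ?E" using arcs_symmetric by (auto intro: symI)
    then show ?thesis using that sym_rtrancl by (meson symE)
  qed
  note V = wellformed'[OF arcs(1)] wellformed'[OF arcs(2)]
  have trans: "(u, w) \<in> ?E\<^sup>*" if "(u, v) \<in> ?E\<^sup>*" "(v, w) \<in> ?E\<^sup>*" for u v w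
    using that by (rule rtrancl_trans)
  have "(p', q\<^sub>0) \<in> ?E\<^sup>* \<or> (p', q') \<in> ?E\<^sup>*"
  proof -
    obtain w where w: "(w, q) \<in> parcs G" "w \<noteq> p" "(p', w) \<in> ?E\<^sup>*"
      using reach_neighbour_avoiding[OF conn(1), of p' q] V d by auto
    then have "w \<in> {q\<^sub>0, p, q'}" using arcs_symmetric q by blast
    then show ?thesis using w by auto
  qed
  moreover have "(q', p\<^sub>0) \<in> ?E\<^sup>* \<or> (q', p') \<in> ?E\<^sup>*"
  proof -
    have [simp]: "{q, p} = {p, q}" by auto
    obtain w where w: "(w, p) \<in> parcs G" "w \<noteq> q" "(q', w) \<in> ?E\<^sup>*"
      using reach_neighbour_avoiding[OF conn(2), of q' p] V d by auto
    then have "w \<in> {p\<^sub>0, q, p'}" using arcs_symmetric p by blast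
    then show ?thesis using w by auto
  qed
  moreover have "(p\<^sub>0, q\<^sub>0) \<in> ?E\<^sup>*" using assms(5) d by auto
  ultimately have "(p', q') \<in> ?E\<^sup>*" using sym trans by meson
  then obtain r where r: "pcas p' r q'" "set r \<subseteq> ?E" "distinct (p' # map snd r)"
    by (rule distinct_path_avoiding)
  have "r \<noteq> []" using r(1) d by auto
  \<comment> \<open>As \<open>r\<close> avoids \<open>p\<close> and \<open>q\<close>, closing it
    through the rung \<open>qp\<close> repeats no vertex.\<close>
  let ?c = "(p, p') # r @ [(q', q), (q, p)]"
  have "pcas p ?c p" using r(1) by (auto simp: pcas_append simp del: cas_append_iff)
  moreover have "set ?c \<subseteq> parcs G" using r(2) arcs arcs_symmetric by auto
  moreover have "distinct (map snd ?c)" using r(2,3) d by auto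
  ultimately have "ucycle G ?c" unfolding ucycle_iff by auto
  then have "cycle_through G (p, p') (q, q') ?c"
    unfolding cycle_through_def by (auto simp: same_edge_def)
  then show ?thesis by (rule that)
qed

text \<open>
  As \<open>G\<close> is cubic, the images of the at least three neighbours of \<open>v\<close> in \<open>T\<close> are all the
  neighbours of \<open>h v\<close>; hence the image of \<open>h\<close> is closed under adjacency.
\<close>
lemma cubic_hom_iso:
  assumes "cubic G" "connected (with_proj G)"
    and T: "pair_wf_digraph T" "pverts T \<noteq> {}"
      "\<And>v. v \<in> pverts T \<Longrightarrow> 3 \<le> card (parcs T `` {v})"
    and h: "inj_on h (pverts T)" "\<And>u v. (u, v) \<in> parcs T \<Longrightarrow> (h u, h v) \<in> parcs G"
  shows "pverts G = h ` pverts T" "parcs G = map_prod h h ` parcs T"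
proof -
  interpret T: pair_wf_digraph T by fact
  have nb: "parcs G `` {h v} = h ` (parcs T `` {v})" if v: "v \<in> pverts T" for v
  proof -
    have sub: "h ` (parcs T `` {v}) \<subseteq> parcs G `` {h v}" using h(2) by auto
    have "parcs T `` {v} \<noteq> {}" using T(3)[OF v] by auto
    then have "h v \<in> pverts G" using h(2) in_arcsD1 by blast
    then have "card (parcs G `` {h v}) = 3" using assms(1) by (intro card_neighbours)
    moreover have "inj_on h (parcs T `` {v})"
      by (rule inj_on_subset[OF h(1)]) (use T.wellformed' in auto)
    ultimately have "card (parcs G `` {h v}) \<le> card (h ` (parcs T `` {v}))"
      using T(3)[OF v] by (simp add: card_image)
    then show ?thesis using sub card_seteq[OF finite_neighbours sub] by auto
  qed
  show V: "pverts G = h ` pverts T"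
  proof (rule connected_closed_set[OF assms(2), symmetric])
    have "parcs T `` {v} \<noteq> {}" if "v \<in> pverts T" for v using T(3)[OF that] by auto
    then show "h ` pverts T \<subseteq> pverts G" using h(2) in_arcsD1 by blast
    fix u v assume "u \<in> h ` pverts T" "(u, v) \<in> parcs G"
    then show "v \<in> h ` pverts T" using nb T.wellformed' by blast
  qed (use T(2) in simp)
  show "parcs G = map_prod h h ` parcs T"
  proof
    show "parcs G \<subseteq> map_prod h h ` parcs T"
    proof
      fix a assume a: "a \<in> parcs G"
      obtain u v where uv: "a = (u, v)" by (cases a)
      then obtain u' where u': "u' \<in> pverts T" "u = h u'" using V a in_arcsD1 by blast
      then have "v \<in> h ` (parcs T `` {u'})" using a uv nb by blast
      then show "a \<in> map_prod h h ` parcs T" using u' uv by (auto intro: rev_image_eqI)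
    qed
  qed (use h(2) in auto)
qed

end

section \<open>Ladders\<close>

lemma map_prod_image_converse: "map_prod h h ` (R\<inverse>) = (map_prod h h ` R)\<inverse>"
  by force

text \<open>Each edge occurs in one direction only; the symmetric closure is taken where the
  relation is used. With \<open>k\<close> rungs, rails stop at rung \<open>k - 1\<close>, so nothing
  wraps around.\<close>

definition open_ladder :: "nat \<Rightarrow> (nat \<times> bool) rel" where
  "open_ladder k = {((i, s), (i + 1, s)) | i s. i + 1 < k} \<union> {((i, False), (i, True)) | i. i < k}"

text \<open>The ladder for \<open>t = False\<close>, the Moebius ladder for \<open>t = True\<close>.\<close>
definition twisted_ladder :: "nat \<Rightarrow> bool \<Rightarrow> (nat \<times> bool) pair_pre_digraph" where
  "twisted_ladder k t =
     (let R = open_ladder k \<union> range (\<lambda>s. ((k - 1, s), (0, s \<noteq> t)))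
      in \<lparr>pverts = {..<k} \<times> UNIV, parcs = R \<union> R\<inverse>\<rparr>)"

lemma pverts_twisted_ladder [simp]: "pverts (twisted_ladder k t) = {..<k} \<times> UNIV"
  by (simp add: twisted_ladder_def Let_def)

lemma parcs_twisted_ladder:
  "parcs (twisted_ladder k t) =
     (open_ladder k \<union> range (\<lambda>s. ((k - 1, s), (0, s \<noteq> t)))) \<union>
     (open_ladder k \<union> range (\<lambda>s. ((k - 1, s), (0, s \<noteq> t))))\<inverse>"
  by (simp add: twisted_ladder_def Let_def)

lemma pair_wf_twisted_ladder: "0 < k \<Longrightarrow> pair_wf_digraph (twisted_ladder k t)"
  by unfold_locales (auto simp: parcs_twisted_ladder open_ladder_def)

text \<open>Three rungs keep the next and the previous vertex apart; with two rungs and no twist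
  they would coincide. The lower bound is what \<open>cubic_hom_iso\<close> asks for.\<close>

lemma twisted_ladder_degree:
  assumes "3 \<le> k" "v \<in> pverts (twisted_ladder k t)"
  shows "3 \<le> card (parcs (twisted_ladder k t) `` {v})"
proof -
  obtain i s where v: "v = (i, s)" "i < k" using assms(2) by auto
  define nxt where "nxt = (if i + 1 < k then (i + 1, s) else (0, s \<noteq> t))"
  \<comment> \<open>Going back across the seam applies the same twist, since
    \<open>s \<noteq> t\<close> as a function of \<open>s\<close> is its own inverse.\<close>
  define prv where "prv = (if 0 < i then (i - 1, s) else (k - 1, s \<noteq> t))"
  have "((i, s), nxt) \<in> parcs (twisted_ladder k t)"
  proof (cases "i + 1 < k")
    case False
    then have "i = k - 1" using v(2) by simp
    then show ?thesis using False by (auto simp: parcs_twisted_ladder open_ladder_def nxt_def)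
  qed (auto simp: parcs_twisted_ladder open_ladder_def nxt_def)
  moreover have "((i, s), prv) \<in> parcs (twisted_ladder k t)"
    using v(2) by (auto simp: parcs_twisted_ladder open_ladder_def prv_def)
  moreover have "((i, s), (i, \<not> s)) \<in> parcs (twisted_ladder k t)"
    using v(2) by (cases s) (auto simp: parcs_twisted_ladder open_ladder_def)
  ultimately have "{nxt, prv, (i, \<not> s)} \<subseteq> parcs (twisted_ladder k t) `` {v}"
    using v(1) by auto
  moreover have "card {nxt, prv, (i, \<not> s)} = 3"
    using assms(1) v(2) by (auto simp: nxt_def prv_def card_insert_if)
  moreover have "finite (parcs (twisted_ladder k t) `` {v})"
  proof (rule finite_subset)
    interpret pair_wf_digraph "twisted_ladder k t"
      by (rule pair_wf_twisted_ladder) (use v in simp)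
    show "parcs (twisted_ladder k t) `` {v} \<subseteq> {..<k} \<times> UNIV" using wellformed' by auto
  qed simp
  ultimately show ?thesis using card_mono by metis
qed

lemma twisted_ladder_False:
  assumes "0 < k"
  shows "twisted_ladder k False = ladder k"
proof -
  have rails: "{((i, s), ((i + 1) mod k, s)) | i s. i < k} =
      {((i, s), (i + 1, s)) | i s. i + 1 < k} \<union> range (\<lambda>s. ((k - 1, s), (0, s \<noteq> False)))"
    (is "?L = ?A \<union> ?B")
  proof
    show "?L \<subseteq> ?A \<union> ?B"
    proof
      fix a assume "a \<in> ?L"
      then obtain i s where a: "a = ((i, s), ((i + 1) mod k, s))" "i < k" by blast
      show "a \<in> ?A \<union> ?B"
      proof (cases "i + 1 < k")
        case False
        then have "i = k - 1" "i + 1 = k" using a(2) by auto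
        then have "a \<in> ?B" using a(1) by simp
        then show ?thesis by blast
      qed (use a in auto)
    qed
    have "((k - 1, s), (0, s)) \<in> ?L" for s
      using assms by (auto intro!: exI[of _ "k - 1"])
    then show "?A \<union> ?B \<subseteq> ?L" by auto
  qed
  show ?thesis
    unfolding twisted_ladder_def open_ladder_def ladder_def Let_def rails
    by (simp only: Un_ac)
qed

text \<open>The twist joins the two rails into a single cycle of length \<open>2 * k\<close>: first
  the rail \<open>False\<close> as 0 to \<open>k - 1\<close>, then the rail \<open>True\<close> as
  \<open>k\<close> to \<open>2 * k - 1\<close>. The rungs become the chords.\<close>

lemma twisted_ladder_True:
  assumes "0 < k"
  shows "graph_iso (twisted_ladder k True) (moebius_ladder k)"
proof (rule graph_isoI)
  let ?h = "\<lambda>(i, s). if s then i + k else i"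
  show "pair_wf_digraph (twisted_ladder k True)" using assms by (rule pair_wf_twisted_ladder)
  show "inj_on ?h (pverts (twisted_ladder k True))" by (auto simp: inj_on_def split: if_splits)
  have V: "?h ` ({..<k} \<times> UNIV) = {..<2 * k}"
  proof
    show "{..<2 * k} \<subseteq> ?h ` ({..<k} \<times> UNIV)"
    proof
      fix j assume "j \<in> {..<2 * k}"
      then have "j = ?h (if j < k then (j, False) else (j - k, True))"
        "(if j < k then (j, False) else (j - k, True)) \<in> {..<k} \<times> (UNIV :: bool set)"
        by auto
      then show "j \<in> ?h ` ({..<k} \<times> UNIV)" by (rule image_eqI)
    qed
  qed auto
  then show "pverts (moebius_ladder k) = ?h ` pverts (twisted_ladder k True)"
    by (simp add: moebius_ladder_def Let_def)
  let ?R = "{((i, s), (i + 1, s)) | i s. i + 1 < k} \<union> {((i, False), (i, True)) | i. i < k} \<union>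
              range (\<lambda>s. ((k - 1, s), (0, s \<noteq> True)))"
  let ?M = "{(i, (i + 1) mod (2 * k)) | i. i < 2 * k} \<union> {(i, i + k) | i. i < k}"
  have "map_prod ?h ?h ` ?R = ?M"
  proof
    show "map_prod ?h ?h ` ?R \<subseteq> ?M"
    proof
      fix a assume "a \<in> map_prod ?h ?h ` ?R"
      then consider i s where "a = (?h (i, s), ?h (i + 1, s))" "i + 1 < k"
        | i where "a = (i, i + k)" "i < k" | s where "a = (?h (k - 1, s), ?h (0, \<not> s))"
        by fastforce
      then show "a \<in> ?M"
      proof cases
        case 1
        then have "a = (?h (i, s), (?h (i, s) + 1) mod (2 * k))" "?h (i, s) < 2 * k" by auto
        then show ?thesis by blast
      next
        \<comment> \<open>The two seam arcs are the cycle steps from \<open>k - 1\<close> to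
          \<open>k\<close> and from \<open>2 * k - 1\<close> to 0.\<close>
        case 3
        then have "a = (?h (k - 1, s), (?h (k - 1, s) + 1) mod (2 * k))" "?h (k - 1, s) < 2 * k"
          using assms by (auto simp: mult_2)
        then show ?thesis by blast
      qed auto
    qed
    show "?M \<subseteq> map_prod ?h ?h ` ?R"
    proof
      fix a assume "a \<in> ?M"
      then consider j where "a = (j, (j + 1) mod (2 * k))" "j < 2 * k"
        | i where "a = (i, i + k)" "i < k" by blast
      then show "a \<in> map_prod ?h ?h ` ?R"
      proof cases
        case 1
        then have "j \<in> ?h ` ({..<k} \<times> UNIV)" using V by blast
        then obtain i s where j: "j = ?h (i, s)" "i < k" by blast
        show ?thesis
        proof (cases "i + 1 < k")
          case True
          then have "a = map_prod ?h ?h ((i, s), (i + 1, s))" using 1 j by auto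
          then show ?thesis using True by blast
        next
          case False
          then have "i = k - 1" using j by simp
          then have "a = map_prod ?h ?h ((k - 1, s), (0, s \<noteq> True))"
            using 1 j assms by (auto simp: mult_2)
          then show ?thesis by blast
        qed
      next
        case 2
        then have "a = map_prod ?h ?h ((i, False), (i, True))" by simp
        then show ?thesis using 2 by blast
      qed
    qed
  qed
  then have "map_prod ?h ?h ` (?R \<union> ?R\<inverse>) = ?M \<union> ?M\<inverse>"
    by (simp only: image_Un map_prod_image_converse)
  then show "parcs (moebius_ladder k) = map_prod ?h ?h ` parcs (twisted_ladder k True)"
    unfolding parcs_twisted_ladder open_ladder_def moebius_ladder_def Let_def by simp
qed

section \<open>Bridging along a ladder\<close>

lemma pverts_bridge [simp]: "pverts (bridge H e f x y) = pverts H \<union> {x, y}"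
  by (simp add: bridge_def Let_def insert_commute)

lemma bridge_same_edge:
  assumes "same_edge e e'" "same_edge f f'"
  shows "bridge H e f x y = bridge H e' f' x y"
proof -
  have sub: "subdivide K g w = subdivide K g' w" if "same_edge g g'" for K and g g' :: "'a \<times> 'a" and w
    using that by (cases g) (auto simp: same_edge_def subdivide.simps)
  show ?thesis by (simp only: bridge_def sub[OF assms(1)] sub[OF assms(2)])
qed

context pair_graph
begin

text \<open>Since \<open>x\<close> and \<open>y\<close> are new, the second subdivision does not
  disturb the arcs made by the first, and both amount to one removal followed by one
  insertion.\<close>

lemma parcs_bridge:
  assumes "(a, b) \<in> parcs G" "(c, d) \<in> parcs G" "x \<notin> pverts G" "y \<notin> pverts G"
  shows "parcs (bridge G (a, b) (c, d) x y) =
    parcs G - ({(a, b), (c, d)} \<union> {(a, b), (c, d)}\<inverse>) \<union>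
    ({(a, x), (x, b), (c, y), (y, d), (x, y)} \<union> {(a, x), (x, b), (c, y), (y, d), (x, y)}\<inverse>)"
  using assms wellformed'[OF assms(1)] wellformed'[OF assms(2)]
  by (auto simp: bridge_def Let_def)

lemma pair_wf_bridge:
  assumes "(a, b) \<in> parcs G" "(c, d) \<in> parcs G" "x \<notin> pverts G" "y \<notin> pverts G"
  shows "pair_wf_digraph (bridge G (a, b) (c, d) x y)"
  using assms wellformed' by unfold_locales (auto simp: parcs_bridge)

text \<open>In the bridged graph \<open>p\<^sub>0 p\<^sub>1\<close> and \<open>q\<^sub>0 q\<^sub>1\<close> become \<open>p\<^sub>0 x p\<^sub>1\<close> and \<open>q\<^sub>0 y q\<^sub>1\<close>, so the rungs
  \<open>xy\<close> and \<open>p\<^sub>1q\<^sub>1\<close> can exchange their roles.\<close>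
lemma bridge_shift_iso:
  assumes p: "parcs G `` {p\<^sub>1} = {p\<^sub>0, q\<^sub>1, p\<^sub>2}" and q: "parcs G `` {q\<^sub>1} = {q\<^sub>0, p\<^sub>1, q\<^sub>2}"
    and d: "distinct [p\<^sub>0, p\<^sub>1, p\<^sub>2, q\<^sub>0, q\<^sub>1, q\<^sub>2]"
    and xy: "x \<notin> pverts G" "y \<notin> pverts G" "x \<noteq> y"
  shows "graph_iso (bridge G (p\<^sub>0, p\<^sub>1) (q\<^sub>0, q\<^sub>1) x y) (bridge G (p\<^sub>1, p\<^sub>2) (q\<^sub>1, q\<^sub>2) x y)"
proof -
  have arcs: "(p\<^sub>0, p\<^sub>1) \<in> parcs G" "(p\<^sub>1, p\<^sub>2) \<in> parcs G" "(q\<^sub>0, q\<^sub>1) \<in> parcs G" "(q\<^sub>1, q\<^sub>2) \<in> parcs G"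
    "(p\<^sub>1, q\<^sub>1) \<in> parcs G"
    using p q arcs_symmetric by blast+
  note V = wellformed'[OF arcs(1)] wellformed'[OF arcs(2)] wellformed'[OF arcs(3)]
    wellformed'[OF arcs(4)]
  define \<sigma> where "\<sigma> = transpose x p\<^sub>1 \<circ> transpose y q\<^sub>1"
  \<comment> \<open>\<open>N\<close> holds the edges away from \<open>p\<^sub>1\<close> and
    \<open>q\<^sub>1\<close>, unchanged by either bridging, and \<open>S\<close> the five edges at
    these two vertices. \<open>P\<close> and \<open>Q\<close> describe what takes the place of
    \<open>S\<close> after bridging before, respectively beyond, the rung
    \<open>p\<^sub>1q\<^sub>1\<close>.\<close>
  define N where "N = parcs G \<inter> (- {p\<^sub>1, q\<^sub>1}) \<times> (- {p\<^sub>1, q\<^sub>1})"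
  define P where
    "P = {(p\<^sub>0, x), (x, p\<^sub>1), (p\<^sub>1, p\<^sub>2), (q\<^sub>0, y), (y, q\<^sub>1), (q\<^sub>1, q\<^sub>2), (x, y), (p\<^sub>1, q\<^sub>1)}"
  define Q where
    "Q = {(p\<^sub>0, p\<^sub>1), (p\<^sub>1, x), (x, p\<^sub>2), (q\<^sub>0, q\<^sub>1), (q\<^sub>1, y), (y, q\<^sub>2), (x, y), (p\<^sub>1, q\<^sub>1)}"
  define S where "S = {(p\<^sub>0, p\<^sub>1), (p\<^sub>1, p\<^sub>2), (q\<^sub>0, q\<^sub>1), (q\<^sub>1, q\<^sub>2), (p\<^sub>1, q\<^sub>1)}"
  have ne: "x \<noteq> p\<^sub>0" "x \<noteq> p\<^sub>1" "x \<noteq> p\<^sub>2" "x \<noteq> q\<^sub>0" "x \<noteq> q\<^sub>1" "x \<noteq> q\<^sub>2"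
    "y \<noteq> p\<^sub>0" "y \<noteq> p\<^sub>1" "y \<noteq> p\<^sub>2" "y \<noteq> q\<^sub>0" "y \<noteq> q\<^sub>1" "y \<noteq> q\<^sub>2"
    using xy V by auto
  have \<sigma>: "\<sigma> x = p\<^sub>1" "\<sigma> p\<^sub>1 = x" "\<sigma> y = q\<^sub>1" "\<sigma> q\<^sub>1 = y"
    "\<And>v. v \<noteq> x \<Longrightarrow> v \<noteq> y \<Longrightarrow> v \<noteq> p\<^sub>1 \<Longrightarrow> v \<noteq> q\<^sub>1 \<Longrightarrow> \<sigma> v = v"
    using ne d xy(3) by (auto simp: \<sigma>_def transpose_def)
  have in1: "\<And>w. (p\<^sub>1, w) \<in> parcs G \<longleftrightarrow> w \<in> {p\<^sub>0, q\<^sub>1, p\<^sub>2}"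
    "\<And>w. (q\<^sub>1, w) \<in> parcs G \<longleftrightarrow> w \<in> {q\<^sub>0, p\<^sub>1, q\<^sub>2}"
    using p q by blast+
  then have in2: "\<And>w. (w, p\<^sub>1) \<in> parcs G \<longleftrightarrow> w \<in> {p\<^sub>0, q\<^sub>1, p\<^sub>2}"
    "\<And>w. (w, q\<^sub>1) \<in> parcs G \<longleftrightarrow> w \<in> {q\<^sub>0, p\<^sub>1, q\<^sub>2}"
    using arcs_symmetric by blast+
  have dec: "parcs G = N \<union> (S \<union> S\<inverse>)"
  proof (rule set_eqI)
    fix a :: "'a \<times> 'a"
    obtain u v where a: "a = (u, v)" by (cases a)
    consider "u = p\<^sub>1" | "u = q\<^sub>1" | "v = p\<^sub>1" | "v = q\<^sub>1"
      | "u \<notin> {p\<^sub>1, q\<^sub>1}" "v \<notin> {p\<^sub>1, q\<^sub>1}" by blast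
    then show "a \<in> parcs G \<longleftrightarrow> a \<in> N \<union> (S \<union> S\<inverse>)"
    proof cases
      case 1
      show ?thesis unfolding a 1 N_def S_def using in1(1)[of v] d by auto
    next
      case 2
      show ?thesis unfolding a 2 N_def S_def using in1(2)[of v] d by auto
    next
      case 3
      show ?thesis unfolding a 3 N_def S_def using in2(1)[of u] d by auto
    next
      case 4
      show ?thesis unfolding a 4 N_def S_def using in2(2)[of u] d by auto
    next
      case 5
      then show ?thesis unfolding a N_def S_def by auto
    qed
  qed
  have 1: "parcs (bridge G (p\<^sub>0, p\<^sub>1) (q\<^sub>0, q\<^sub>1) x y) = N \<union> (P \<union> P\<inverse>)"
  proof -
    let ?X = "{(p\<^sub>0, p\<^sub>1), (q\<^sub>0, q\<^sub>1)}" and ?R = "{(p\<^sub>1, p\<^sub>2), (q\<^sub>1, q\<^sub>2), (p\<^sub>1, q\<^sub>1)}"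
    have "S = ?X \<union> ?R" by (auto simp: S_def)
    moreover have "(?X \<union> ?X\<inverse>) \<inter> (?R \<union> ?R\<inverse>) = {}" using d by auto
    moreover have "(?X \<union> ?X\<inverse>) \<inter> N = {}" by (auto simp: N_def)
    ultimately have diff: "parcs G - (?X \<union> ?X\<inverse>) = N \<union> (?R \<union> ?R\<inverse>)"
      unfolding dec by blast
    have P: "P = ?R \<union> {(p\<^sub>0, x), (x, p\<^sub>1), (q\<^sub>0, y), (y, q\<^sub>1), (x, y)}" by (auto simp: P_def)
    show ?thesis
      unfolding parcs_bridge[OF arcs(1) arcs(3) xy(1,2)] diff P converse_Un by (simp only: Un_ac)
  qed
  have 2: "parcs (bridge G (p\<^sub>1, p\<^sub>2) (q\<^sub>1, q\<^sub>2) x y) = N \<union> (Q \<union> Q\<inverse>)"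
  proof -
    let ?X = "{(p\<^sub>1, p\<^sub>2), (q\<^sub>1, q\<^sub>2)}" and ?R = "{(p\<^sub>0, p\<^sub>1), (q\<^sub>0, q\<^sub>1), (p\<^sub>1, q\<^sub>1)}"
    have "S = ?X \<union> ?R" by (auto simp: S_def)
    moreover have "(?X \<union> ?X\<inverse>) \<inter> (?R \<union> ?R\<inverse>) = {}" using d by auto
    moreover have "(?X \<union> ?X\<inverse>) \<inter> N = {}" by (auto simp: N_def)
    ultimately have diff: "parcs G - (?X \<union> ?X\<inverse>) = N \<union> (?R \<union> ?R\<inverse>)"
      unfolding dec by blast
    have Q: "Q = ?R \<union> {(p\<^sub>1, x), (x, p\<^sub>2), (q\<^sub>1, y), (y, q\<^sub>2), (x, y)}" by (auto simp: Q_def)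
    show ?thesis
      unfolding parcs_bridge[OF arcs(2) arcs(4) xy(1,2)] diff Q converse_Un by (simp only: Un_ac)
  qed
  have "\<sigma> v = v" if "v \<in> pverts G" "v \<notin> {p\<^sub>1, q\<^sub>1}" for v
    using that xy by (intro \<sigma>(5)) auto
  then have "map_prod \<sigma> \<sigma> a = a" if "a \<in> N" for a
    using that wellformed' unfolding N_def by (cases a) auto
  then have N: "map_prod \<sigma> \<sigma> ` N = N" by simp
  have fix0: "\<sigma> p\<^sub>0 = p\<^sub>0" "\<sigma> p\<^sub>2 = p\<^sub>2" "\<sigma> q\<^sub>0 = q\<^sub>0" "\<sigma> q\<^sub>2 = q\<^sub>2"
    using ne d by (auto intro!: \<sigma>(5))
  \<comment> \<open>The path \<open>p\<^sub>0 x p\<^sub>1 p\<^sub>2\<close> becomes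
    \<open>p\<^sub>0 p\<^sub>1 x p\<^sub>2\<close>, likewise on the other rail, and the two rungs
    are exchanged.\<close>
  have "map_prod \<sigma> \<sigma> ` P = Q"
    unfolding P_def Q_def by (simp add: \<sigma>(1-4) fix0 insert_commute)
  then have PQ: "map_prod \<sigma> \<sigma> ` (P \<union> P\<inverse>) = Q \<union> Q\<inverse>"
    by (simp only: image_Un map_prod_image_converse)
  show ?thesis
  proof (rule graph_isoI[of _ \<sigma>])
    show "pair_wf_digraph (bridge G (p\<^sub>0, p\<^sub>1) (q\<^sub>0, q\<^sub>1) x y)"
      by (rule pair_wf_bridge) (use arcs xy in auto)
    have "inj \<sigma>" unfolding \<sigma>_def by (intro inj_compose) simp_all
    then show "inj_on \<sigma> (pverts (bridge G (p\<^sub>0, p\<^sub>1) (q\<^sub>0, q\<^sub>1) x y))"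
      by (rule inj_on_subset) simp
    have "\<sigma> ` (pverts G \<union> {x, y}) = pverts G \<union> {x, y}"
    proof (rule endo_inj_surj)
      show "inj_on \<sigma> (pverts G \<union> {x, y})" using \<open>inj \<sigma>\<close> by (rule inj_on_subset) simp
      show "\<sigma> ` (pverts G \<union> {x, y}) \<subseteq> pverts G \<union> {x, y}"
        using V by (auto simp: \<sigma>_def transpose_def)
    qed (use pair_finite_verts in simp)
    then show "pverts (bridge G (p\<^sub>1, p\<^sub>2) (q\<^sub>1, q\<^sub>2) x y) =
        \<sigma> ` pverts (bridge G (p\<^sub>0, p\<^sub>1) (q\<^sub>0, q\<^sub>1) x y)" by simp
    show "parcs (bridge G (p\<^sub>1, p\<^sub>2) (q\<^sub>1, q\<^sub>2) x y) =
        map_prod \<sigma> \<sigma> ` parcs (bridge G (p\<^sub>0, p\<^sub>1) (q\<^sub>0, q\<^sub>1) x y)"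
      unfolding 1 2 image_Un[of _ N] N PQ ..
  qed
qed

text \<open>Bridging the two seam edges inserts \<open>xy\<close> between the last rung and rung 0,
  where it serves as rung \<open>k\<close>; the twist moves to the new seam.\<close>

lemma twisted_ladder_bridge:
  assumes "3 \<le> k" and h: "inj_on h (pverts (twisted_ladder k t))"
    and V: "pverts G = h ` pverts (twisted_ladder k t)"
    and A: "parcs G = map_prod h h ` parcs (twisted_ladder k t)"
    and xy: "x \<notin> pverts G" "y \<notin> pverts G" "x \<noteq> y"
  shows "graph_iso (twisted_ladder (k + 1) t)
    (bridge G (h (k - 1, False), h (0, t)) (h (k - 1, True), h (0, \<not> t)) x y)"
proof (rule graph_isoI)
  let ?B = "bridge G (h (k - 1, False), h (0, t)) (h (k - 1, True), h (0, \<not> t)) x y"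
  define g where "g = h((k, False) := x, (k, True) := y)"
  have gh: "g (i, s) = h (i, s)" if "i < k" for i s using that by (simp add: g_def)
  have gk: "g (k, False) = x" "g (k, True) = y" by (simp_all add: g_def)
  show "pair_wf_digraph (twisted_ladder (k + 1) t)" by (rule pair_wf_twisted_ladder) simp
  have dec: "pverts (twisted_ladder (k + 1) t) = {..<k} \<times> UNIV \<union> {(k, False), (k, True)}"
    by (auto simp: less_Suc_eq)
  have img: "g ` ({..<k} \<times> UNIV) = pverts G" 
    unfolding V pverts_twisted_ladder by (rule image_cong) (auto simp: gh)
  have "inj_on g ({..<k} \<times> UNIV)" using h gh by (auto simp: inj_on_def)
  moreover have "inj_on g {(k, False), (k, True)}" using gk xy(3) by (auto simp: inj_on_def)
  ultimately show "inj_on g (pverts (twisted_ladder (k + 1) t))"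
    unfolding dec inj_on_Un using img gk xy(1,2) by auto
  show "pverts ?B = g ` pverts (twisted_ladder (k + 1) t)"
    unfolding dec image_Un img using gk by simp
  let ?O = "open_ladder k"
  \<comment> \<open>\<open>W\<close> is the old seam. \<open>N\<close> is what replaces it: two
    rails from rung \<open>k - 1\<close> to the new rung, the new seam, and the new rung
    itself.\<close>
  define W where "W = range (\<lambda>s. ((k - 1, s), (0::nat, s \<noteq> t)))"
  define N where "N = {((k - 1, False), (k, False)), ((k, False), (0, t)), ((k - 1, True), (k, True)),
    ((k, True), (0, \<not> t)), ((k, False), (k, True))}"
  have T: "parcs (twisted_ladder k t) = (?O \<union> ?O\<inverse>) \<union> (W \<union> W\<inverse>)"
    unfolding parcs_twisted_ladder W_def by blast
  have "open_ladder (k + 1) \<union> range (\<lambda>s. ((k + 1 - 1, s), (0, s \<noteq> t))) = ?O \<union> N"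
  proof
    have "k - 1 < k" "Suc (k - 1) = k" using assms(1) by auto
    then show "?O \<union> N \<subseteq> open_ladder (k + 1) \<union> range (\<lambda>s. ((k + 1 - 1, s), (0, s \<noteq> t)))"
      unfolding open_ladder_def N_def by (auto simp: image_iff)
    show "open_ladder (k + 1) \<union> range (\<lambda>s. ((k + 1 - 1, s), (0, s \<noteq> t))) \<subseteq> ?O \<union> N"
    proof
      fix a assume "a \<in> open_ladder (k + 1) \<union> range (\<lambda>s. ((k + 1 - 1, s), (0, s \<noteq> t)))"
      then consider "a \<in> {((i, s), (i + 1, s)) | i s. i + 1 < k + 1}"
        | "a \<in> {((i, False), (i, True)) | i. i < k + 1}"
        | "a \<in> range (\<lambda>s. ((k + 1 - 1, s), (0, s \<noteq> t)))"
        unfolding open_ladder_def by blast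
      then show "a \<in> ?O \<union> N"
      proof cases
        case 1
        then obtain i s where i: "a = ((i, s), (i + 1, s))" "i < k" by auto
        show ?thesis
        proof (cases "i + 1 < k")
          case True
          then have "a \<in> ?O" unfolding open_ladder_def i(1) by blast
          then show ?thesis by blast
        next
          case False
          then have "i = k - 1" "i + 1 = k" using i by auto
          then have "a = ((k - 1, s), (k, s))" unfolding i(1) by simp
          then show ?thesis by (cases s) (simp_all add: N_def)
        qed
      next
        case 2
        then obtain i where i: "a = ((i, False), (i, True))" "i < k + 1" by auto
        show ?thesis
        proof (cases "i < k")
          case True
          then have "a \<in> ?O" unfolding open_ladder_def i(1) by blast
          then show ?thesis by blast
        next
          case False
          then have "i = k" using i(2) by simp
          then show ?thesis unfolding i(1) by (simp add: N_def)
        qed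
      next
        case 3
        then obtain s where "a = ((k, s), (0, s \<noteq> t))" by auto
        then show ?thesis by (cases s) (simp_all add: N_def)
      qed
    qed
  qed
  then have T': "parcs (twisted_ladder (k + 1) t) = (?O \<union> ?O\<inverse>) \<union> (N \<union> N\<inverse>)"
    unfolding parcs_twisted_ladder by blast
  have Osub: "?O \<union> ?O\<inverse> \<subseteq> ({..<k} \<times> UNIV) \<times> ({..<k} \<times> UNIV)" by (auto simp: open_ladder_def)
  have Wsub: "W \<union> W\<inverse> \<subseteq> ({..<k} \<times> UNIV) \<times> ({..<k} \<times> UNIV)" using assms(1) by (auto simp: W_def)
  have disj: "(?O \<union> ?O\<inverse>) \<inter> (W \<union> W\<inverse>) = {}"
    using assms(1) by (auto simp: open_ladder_def W_def)
  have gO: "map_prod g g ` (?O \<union> ?O\<inverse>) = map_prod h h ` (?O \<union> ?O\<inverse>)"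
    by (rule image_cong) (use Osub gh in auto)
  have inj2: "inj_on (map_prod h h) (({..<k} \<times> UNIV) \<times> ({..<k} \<times> UNIV))"
    using h by (auto intro: map_prod_inj_on)
  \<comment> \<open>Removing the seam must not remove other edges of the ladder; this rests on
    injectivity of \<open>h\<close> and on \<open>3 \<le> k\<close>.\<close>
  have disj': "map_prod h h ` (?O \<union> ?O\<inverse>) \<inter> map_prod h h ` (W \<union> W\<inverse>) = {}"
    using inj_on_image_Int[OF inj2 Osub Wsub] disj by (simp only: image_empty)
  have "W = {((k - 1, False), (0, t)), ((k - 1, True), (0, \<not> t))}"
    unfolding W_def UNIV_bool by auto
  then have hW: "map_prod h h ` (W \<union> W\<inverse>) =
      {(h (k - 1, False), h (0, t)), (h (k - 1, True), h (0, \<not> t))} \<union>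
      {(h (k - 1, False), h (0, t)), (h (k - 1, True), h (0, \<not> t))}\<inverse>"
    unfolding image_Un map_prod_image_converse by simp
  have arcs: "(h (k - 1, False), h (0, t)) \<in> parcs G" "(h (k - 1, True), h (0, \<not> t)) \<in> parcs G"
    unfolding A T image_Un[of _ "?O \<union> ?O\<inverse>"] hW by auto
  have "map_prod g g ` N = {(h (k - 1, False), x), (x, h (0, t)), (h (k - 1, True), y),
      (y, h (0, \<not> t)), (x, y)}"
    unfolding N_def using assms(1) gh[of "k - 1"] gh[of 0] by (simp add: gk)
  then have gN: "map_prod g g ` (N \<union> N\<inverse>) = {(h (k - 1, False), x), (x, h (0, t)), (h (k - 1, True), y),
      (y, h (0, \<not> t)), (x, y)} \<union> {(h (k - 1, False), x), (x, h (0, t)), (h (k - 1, True), y),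
      (y, h (0, \<not> t)), (x, y)}\<inverse>"
    by (simp only: image_Un map_prod_image_converse)
  have "X \<union> Y - Y = X" if "X \<inter> Y = {}" for X Y :: "('a \<times> 'a) set" using that by blast
  from this[OF disj'] have "parcs G - map_prod h h ` (W \<union> W\<inverse>) = map_prod h h ` (?O \<union> ?O\<inverse>)"
    by (simp only: A T image_Un[of _ "?O \<union> ?O\<inverse>"])
  then show "parcs ?B = map_prod g g ` parcs (twisted_ladder (k + 1) t)"
    by (simp only: parcs_bridge[OF arcs xy(1,2)] T' image_Un[of _ "?O \<union> ?O\<inverse>"] gO gN hW)
qed

end

section \<open>Growing the ladder until it closes up or the spread becomes large\<close>

definition bridging_outcome :: "'a pair_pre_digraph \<Rightarrow> 'a pair_pre_digraph \<Rightarrow> bool" where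
  "bridging_outcome H G \<longleftrightarrow>
    (\<exists>k\<ge>4. graph_iso H (ladder k) \<and> graph_iso G (ladder (k + 1))) \<or>
    (\<exists>k\<ge>4. graph_iso H (moebius_ladder k) \<and> graph_iso G (moebius_ladder (k + 1))) \<or>
    (\<exists>e f G'. bridging H e f G' \<and> cycle_spread_at_least H e f (1, 2) \<and> graph_iso G G')"

lemma bridging_outcome_iso:
  assumes "bridging_outcome H G'" "graph_iso G G'"
  shows "bridging_outcome H G"
  using assms(1) graph_iso_trans[OF assms(2)] unfolding bridging_outcome_def by metis

context pair_graph
begin

text \<open>By \<open>cubic_hom_iso\<close> a closed ladder inside \<open>G\<close> is all of
  \<open>G\<close>. Counting vertices then gives \<open>4 \<le> k\<close>, and \<open>t\<close>
  decides between the ladder and the Moebius ladder.\<close>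

lemma bridging_outcome_twisted_ladder:
  assumes "cubic G" "connected (with_proj G)" "8 \<le> card (pverts G)" and k: "3 \<le> k"
    and h: "inj_on h ({..<k} \<times> UNIV)"
      "\<And>u v. (u, v) \<in> open_ladder k \<Longrightarrow> (h u, h v) \<in> parcs G"
    and wrap: "\<And>s. (h (k - 1, s), h (0, s \<noteq> t)) \<in> parcs G"
    and xy: "x \<notin> pverts G" "y \<notin> pverts G" "x \<noteq> y"
  shows "bridging_outcome G (bridge G (h (k - 1, False), h (0, t)) (h (k - 1, True), h (0, \<not> t)) x y)"
    (is "bridging_outcome G ?B")
proof -
  let ?T = "twisted_ladder k t"
  have inj: "inj_on h (pverts ?T)" using h(1) by simp
  have wf: "pair_wf_digraph ?T" using k by (intro pair_wf_twisted_ladder) simp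
  have "(h u, h v) \<in> parcs G" if "(u, v) \<in> parcs ?T" for u v
  proof -
    let ?R = "open_ladder k \<union> range (\<lambda>s. ((k - 1, s), (0, s \<noteq> t)))"
    have R: "(h u, h v) \<in> parcs G" if "(u, v) \<in> ?R" for u v
      using that h(2) wrap by blast
    from that consider "(u, v) \<in> ?R" | "(v, u) \<in> ?R" unfolding parcs_twisted_ladder by blast
    then show ?thesis using R arcs_symmetric by cases blast+
  qed
  moreover have "pverts ?T \<noteq> {}" using k by (simp add: lessThan_empty_iff)
  ultimately have V: "pverts G = h ` pverts ?T" and A: "parcs G = map_prod h h ` parcs ?T"
    using cubic_hom_iso[OF assms(1,2) wf _ twisted_ladder_degree[OF k] inj] by blast+
  have "card (pverts G) = card ({..<k} \<times> (UNIV :: bool set))"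
    unfolding V card_image[OF inj] by simp
  then have "4 \<le> k" using assms(3) by (simp add: card_cartesian_product)
  have GT: "graph_iso G ?T" by (rule graph_iso_sym) (rule graph_isoI[OF wf inj V A])
  have BT: "graph_iso ?B (twisted_ladder (k + 1) t)"
    by (rule graph_iso_sym) (rule twisted_ladder_bridge[OF k inj V A xy])
  show ?thesis
  proof (cases t)
    case True
    then have moebius: "graph_iso (twisted_ladder j t) (moebius_ladder j)" if "0 < j" for j
      using twisted_ladder_True[OF that] by simp
    have "graph_iso G (moebius_ladder k)"
      by (rule graph_iso_trans[OF GT]) (rule moebius, use k in simp)
    moreover have "graph_iso ?B (moebius_ladder (k + 1))"
      by (rule graph_iso_trans[OF BT]) (rule moebius, simp)
    ultimately show ?thesis using \<open>4 \<le> k\<close> unfolding bridging_outcome_def by blast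
  next
    case False
    then have "graph_iso G (ladder k)" "graph_iso ?B (ladder (k + 1))"
      using GT BT twisted_ladder_False k by simp_all
    then show ?thesis using \<open>4 \<le> k\<close> unfolding bridging_outcome_def by blast
  qed
qed

text \<open>The rungs are numbered 0 to \<open>m\<close>, and the bridged edges are the last pair of
  rails. The induction lengthens the ladder, replacing \<open>h\<close> each time; the number of
  vertices bounds its length.\<close>

lemma bridging_outcome_open_ladder:
  assumes "cubic G" "triangle_free G" "two_connected G" "8 \<le> card (pverts G)"
    and xy: "x \<notin> pverts G" "y \<notin> pverts G" "x \<noteq> y"
    and "0 < m" "inj_on h ({..<m + 1} \<times> UNIV)"
      "\<And>u v. (u, v) \<in> open_ladder (m + 1) \<Longrightarrow> (h u, h v) \<in> parcs G"
  shows "bridging_outcome G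
    (bridge G (h (m - 1, False), h (m, False)) (h (m - 1, True), h (m, True)) x y)"
  using assms(8-10)
proof (induction "card (pverts G) - m" arbitrary: m h rule: less_induct)
  case less
  note inj = less.prems(2) and hom = less.prems(3)
  have conn: "connected (with_proj G)" "\<And>v. v \<in> pverts G \<Longrightarrow> connected (del_vert v)"
    using assms(3) unfolding two_connected_def by auto
  note sym = arcs_symmetric
  have rung: "(h (i, s), h (i, \<not> s)) \<in> parcs G" if "i \<le> m" for i s
  proof -
    have "((i, False), (i, True)) \<in> open_ladder (m + 1)"
      using that by (simp add: open_ladder_def)
    then have "(h (i, False), h (i, True)) \<in> parcs G" by (rule hom)
    then show ?thesis using sym by (cases s) auto
  qed
  have rail: "(h (i, s), h (i + 1, s)) \<in> parcs G" if "i < m" for i s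
    using that by (intro hom) (simp add: open_ladder_def)
  have heq: "h (i, s) = h (j, r) \<longleftrightarrow> i = j \<and> s = r" if "i \<le> m" "j \<le> m" for i j s r
    using inj_on_eq_iff[OF inj, of "(i, s)" "(j, r)"] that by auto
  have prev_rail: "(h (m, s), h (m - 1, s)) \<in> parcs G" for s
    using rail[of "m - 1" s] less.prems(1) sym by simp
  have "\<exists>c. parcs G `` {h (m, s)} = {h (m - 1, s), h (m, \<not> s), c} \<and>
      c \<noteq> h (m - 1, s) \<and> c \<noteq> h (m, \<not> s) \<and> (h (m, s), c) \<in> parcs G" for s
  proof -
    have "h (m - 1, s) \<noteq> h (m, \<not> s)" using heq less.prems(1) by simp
    then obtain c where "parcs G `` {h (m, s)} = {h (m - 1, s), h (m, \<not> s), c}"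
        "c \<noteq> h (m - 1, s)" "c \<noteq> h (m, \<not> s)" "(h (m, s), c) \<in> parcs G"
      by (rule third_neighbour[OF assms(1) prev_rail[of s] rung[OF order_refl]])
    then show ?thesis by blast
  qed
  \<comment> \<open>\<open>c s\<close> continues the rail \<open>s\<close> beyond the last
    rung.\<close>
  then obtain c where c: "\<And>s. parcs G `` {h (m, s)} = {h (m - 1, s), h (m, \<not> s), c s}"
      "\<And>s. c s \<noteq> h (m - 1, s)" "\<And>s. c s \<noteq> h (m, \<not> s)" "\<And>s. (h (m, s), c s) \<in> parcs G"
    by metis
  have c_loop: "c s \<noteq> h (m, s)" for s using c(4)[of s] no_loops' by force
  \<comment> \<open>A rail can run back into the ladder only at rung 0: for \<open>0 < i < m\<close>
    the three neighbours are already on the ladder, which leaves only the preceding vertex of the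
    same rail, excluded by the choice of \<open>c\<close>. With just two rungs, returning to rung 0
    would repeat that vertex or make a triangle.\<close>
  have closing: "i = 0 \<and> 2 \<le> m" if ci: "c s = h (i, r)" "i \<le> m" for s i r
  proof -
    have "i \<noteq> m" using c_loop[of s] c(3)[of s] ci by (cases "r = s") auto
    moreover have False if "0 < i" "i < m"
    proof -
      have "(h (i, r), h (i - 1, r)) \<in> parcs G" using rail[of "i - 1" r] that sym by simp
      moreover have "(h (i, r), h (i + 1, r)) \<in> parcs G" using rail that by simp
      moreover have "(h (i, r), h (i, \<not> r)) \<in> parcs G" using rung that by simp
      ultimately have "parcs G `` {h (i, r)} = {h (i - 1, r), h (i + 1, r), h (i, \<not> r)}"
        using that by (intro neighbours_eq[OF assms(1)]) (auto simp: heq)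
      moreover have "(h (i, r), h (m, s)) \<in> parcs G" using c(4)[of s] ci sym by simp
      ultimately have "h (m, s) = h (i - 1, r) \<or> h (m, s) = h (i + 1, r) \<or> h (m, s) = h (i, \<not> r)"
        by blast
      then have "m = i + 1" "s = r" using that by (auto simp: heq)
      then show False using c(2)[of s] ci by simp
    qed
    ultimately have "i = 0" using ci(2) by force
    moreover have False if "m = 1"
    proof (cases "r = s")
      case True
      then show False using c(2)[of s] ci(1) \<open>i = 0\<close> that by simp
    next
      case False
      then have "c s = h (0, \<not> s)" using ci(1) \<open>i = 0\<close> by simp
      then have "(h (1, s), h (0, \<not> s)) \<in> parcs G" using c(4)[of s] that by simp
      moreover have "(h (0, \<not> s), h (0, s)) \<in> parcs G" using rung[of 0 s] sym by simp
      moreover have "(h (0, s), h (1, s)) \<in> parcs G" using rail[of 0 s] that by simp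
      ultimately show False using triangle_freeD[OF assms(2)] by blast
    qed
    ultimately show ?thesis using less.prems(1) by force
  qed
  \<comment> \<open>Here \<open>closing\<close> would demand both \<open>m - 1 = 0\<close> and
    \<open>2 \<le> m\<close>.\<close>
  have c_prev: "c s \<noteq> h (m - 1, r)" for s r
    using closing[of s "m - 1" r] by auto
  have c_ne: "c False \<noteq> c True"
  proof
    assume "c False = c True"
    then have "(c False, h (m, False)) \<in> parcs G" "(h (m, True), c False) \<in> parcs G"
      using c(4)[of False] c(4)[of True] sym by auto
    moreover have "(h (m, False), h (m, True)) \<in> parcs G" using rung[of m False] by simp
    ultimately show False using triangle_freeD[OF assms(2)] by blast
  qed
  have c_end: "c s \<noteq> h (m, r)" for s r using c_loop[of s] c(3)[of s] by (cases "r = s") auto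
  have dist: "distinct [h (m - 1, False), h (m, False), c False, h (m - 1, True), h (m, True), c True]"
    using less.prems(1) c_prev c_end c_ne c_prev[symmetric] c_end[symmetric] by (simp add: heq)
  have nb: "parcs G `` {h (m, False)} = {h (m - 1, False), h (m, True), c False}"
    "parcs G `` {h (m, True)} = {h (m - 1, True), h (m, False), c True}"
    using c(1)[of False] c(1)[of True] by simp_all
  \<comment> \<open>It is enough to treat the bridging one step further along;
    \<open>bridge_shift_iso\<close> carries the result back at the end.\<close>
  let ?B = "bridge G (h (m, False), c False) (h (m, True), c True) x y"
  have wfB: "pair_wf_digraph ?B" using c(4) xy by (intro pair_wf_bridge) auto
  have "bridging_outcome G ?B"
  proof (cases "(c False, c True) \<in> parcs G")
    case False
    let ?e = "(h (m, False), c False)" and ?f = "(h (m, True), c True)"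
    have V: "h (m, s) \<in> pverts G" for s using c(4) by (rule in_arcsD1)
    have prev: "(h (m - 1, False), h (m - 1, True)) \<in> parcs G" using rung[of "m - 1" False] by simp
    have "distinct [h (m - 1, False), h (m - 1, True), h (m, False), h (m, True), c False, c True]"
      using dist by auto
    then obtain r where r: "cycle_through G ?e ?f r"
      by (rule cycle_through_ladder_end[OF conn(2)[OF V] conn(2)[OF V] nb prev])
    have disj: "{fst ?e, snd ?e} \<inter> {fst ?f, snd ?f} = {}" using dist by auto
    have "cycle_spread_at_least G ?e ?f (1, 2)"
    proof (rule cycle_spread_at_least_1_2[OF r disj])
      fix a b c' d
      assume *: "same_edge ?e (b, a)" "same_edge ?f (c', d)" "(a, c') \<in> parcs G" "(d, b) \<in> parcs G"
      \<comment> \<open>The neighbours of the last rung are known, so no edge crosses from one rail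
        to the other there. A 4-cycle through both edges would thus need the missing edge between
        \<open>c False\<close> and \<open>c True\<close>.\<close>
      have nF: "(h (m, False), c True) \<notin> parcs G" "(h (m, True), c False) \<notin> parcs G"
        unfolding Image_singleton_iff[symmetric] nb using dist by auto
      have nF': "(c True, h (m, False)) \<notin> parcs G" "(c False, h (m, True)) \<notin> parcs G"
        "(c True, c False) \<notin> parcs G"
        using nF False sym by blast+
      show False using * nF nF' False by (auto simp: same_edge_def)
    qed
    moreover have "bridging G ?e ?f ?B"
      unfolding bridging_def using c(4) xy dist by (auto simp: same_edge_def)
    ultimately show ?thesis
      unfolding bridging_outcome_def using graph_iso_refl[OF wfB] by blast
  next
    case adj: True
    show ?thesis
    proof (cases "\<exists>s. c s \<in> h ` ({..<m + 1} \<times> UNIV)")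
      case False
      \<comment> \<open>The two new vertices are adjacent, so they form rung \<open>m + 1\<close> of
        a longer ladder.\<close>
      define g where "g = (\<lambda>(i, s). if i = m + 1 then c s else h (i, s))"
      have g: "g (i, s) = h (i, s)" if "i \<le> m" for i s using that by (simp add: g_def)
      have g': "g (Suc m, s) = c s" for s by (simp add: g_def)
      have dec: "{..<m + 1 + 1} \<times> (UNIV :: bool set) = {..<m + 1} \<times> UNIV \<union> {m + 1} \<times> UNIV"
        by (auto simp: less_Suc_eq)
      have inj1: "inj_on g ({..<m + 1} \<times> UNIV)" using heq by (auto simp: inj_on_def g)
      have inj2: "inj_on g ({m + 1} \<times> UNIV)"
        using c_ne c_ne[symmetric] by (auto simp: inj_on_def g' all_bool_eq)
      have img: "g ` ({..<m + 1} \<times> UNIV) = h ` ({..<m + 1} \<times> UNIV)"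
        by (rule image_cong) (auto simp: g)
      have "v \<notin> g ` ({..<m + 1} \<times> UNIV)" if "v \<in> g ` ({m + 1} \<times> UNIV)" for v
      proof -
        from that obtain s where "v = c s" by (auto simp: g')
        then show ?thesis using False img by metis
      qed
      then have "g ` ({..<m + 1} \<times> UNIV) \<inter> g ` ({m + 1} \<times> UNIV) = {}"
        unfolding disjoint_iff by metis
      moreover have "({..<m + 1} \<times> (UNIV :: bool set)) \<inter> {m + 1} \<times> UNIV = {}" by auto
      ultimately have inj': "inj_on g ({..<m + 1 + 1} \<times> UNIV)"
        unfolding dec inj_on_Un using inj1 inj2 by (simp only: Diff_triv Int_commute)
      have hom': "(g u, g v) \<in> parcs G" if "(u, v) \<in> open_ladder (m + 1 + 1)" for u v
      proof -
        from that consider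
          "(u, v) \<in> {((i, s), (i + 1, s)) | i s. i + 1 < m + 1 + 1}"
          | "(u, v) \<in> {((i, False), (i, True)) | i. i < m + 1 + 1}"
          unfolding open_ladder_def by blast
        then show ?thesis
        proof cases
          case 1
          then obtain i s where i: "u = (i, s)" "v = (i + 1, s)" "i \<le> m" by auto
          show ?thesis
          proof (cases "i = m")
            case True
            then show ?thesis using i c(4) by (simp add: g g')
          next
            case False
            then show ?thesis using i rail[of i s] by (simp add: g)
          qed
        next
          case 2
          then obtain i where i: "u = (i, False)" "v = (i, True)" "i \<le> m + 1" by auto
          show ?thesis
          proof (cases "i = m + 1")
            case True
            then show ?thesis using adj by (simp add: i(1,2) True g')
          next
            case False
            then show ?thesis using i rung[of i False] by (simp add: g)
          qed
        qed
      qed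
      \<comment> \<open>The ladder embeds in \<open>G\<close>, so \<open>m\<close> is below the
        number of vertices and the truncated difference really drops.\<close>
      have "card ({..<m + 1} \<times> (UNIV :: bool set)) \<le> card (pverts G)"
      proof (rule card_inj_on_le[OF inj])
        show "h ` ({..<m + 1} \<times> UNIV) \<subseteq> pverts G" 
          using in_arcsD1[OF rung] by (auto simp: less_Suc_eq_le)
      qed (rule pair_finite_verts)
      then have "card (pverts G) - (m + 1) < card (pverts G) - m"
        by (simp add: card_cartesian_product)
      from less.hyps[OF this _ inj' hom'] show ?thesis by (simp add: g g')
    next
      case True
      then obtain s i r where ci: "c s = h (i, r)" "i \<le> m" by (auto simp: less_Suc_eq_le)
      from closing[OF ci] have "i = 0" and m: "2 \<le> m" by auto
      have c0: "c s = h (0, r)" using ci(1) \<open>i = 0\<close> by simp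
      \<comment> \<open>All neighbours of \<open>h (0, r)\<close> are now known. The vertex
        \<open>c (\<not> s)\<close> is among them, and only the other end of rung 0 is left for
        it.\<close>
      have "parcs G `` {h (0, r)} = {h (1, r), h (0, \<not> r), h (m, s)}"
      proof (rule neighbours_eq[OF assms(1)])
        show "(h (0, r), h (1, r)) \<in> parcs G" using rail[of 0 r] m by simp
        show "(h (0, r), h (0, \<not> r)) \<in> parcs G" using rung by simp
        show "(h (0, r), h (m, s)) \<in> parcs G" using c(4)[of s] c0 sym by simp
      qed (use m in \<open>auto simp: heq\<close>)
      moreover have "(c s, c (\<not> s)) \<in> parcs G" using adj sym by (cases s) auto
      ultimately have "c (\<not> s) = h (1, r) \<or> c (\<not> s) = h (0, \<not> r) \<or> c (\<not> s) = h (m, s)"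
        using c0 by auto
      then have c1: "c (\<not> s) = h (0, \<not> r)"
        using closing[of "\<not> s" 1 r] c_end m by auto
      \<comment> \<open>\<open>t\<close> records whether the rails meet rung 0 straight or
        crossed.\<close>
      define t where "t = (r \<noteq> s)"
      have ct: "c q = h (0, q \<noteq> t)" for q
        using c0 c1 unfolding t_def by (cases q; cases s; cases r) simp_all
      have "bridging_outcome G (bridge G (h (m + 1 - 1, False), h (0, t))
          (h (m + 1 - 1, True), h (0, \<not> t)) x y)"
      proof (rule bridging_outcome_twisted_ladder[OF assms(1) conn(1) assms(4) _ inj hom _ xy])
        show "(h (m + 1 - 1, q), h (0, q \<noteq> t)) \<in> parcs G" for q using c(4)[of q] ct by simp
      qed (use m in simp_all)
      then show ?thesis using ct[of False] ct[of True] by simp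
    qed
  qed
  then show ?case
    by (rule bridging_outcome_iso) (rule bridge_shift_iso[OF nb dist xy])
qed

end

theorem theorem3p1:
  fixes H G :: "'a pair_pre_digraph" and e f :: "'a \<times> 'a"
  assumes "pair_graph H" and "cubic H" and "triangle_free H" and "two_connected H"
    and "8 \<le> card (pverts H)"
    and "bridging H e f G" and "cycle_spread_at_least H e f (1, 1)"
  shows "(\<exists>k\<ge>4. graph_iso H (ladder k) \<and> graph_iso G (ladder (k + 1))) \<or>
         (\<exists>k\<ge>4. graph_iso H (moebius_ladder k) \<and> graph_iso G (moebius_ladder (k + 1))) \<or>
         (\<exists>e' f' G'. bridging H e' f' G' \<and> cycle_spread_at_least H e' f' (1, 2) \<and> graph_iso G G')"
proof -
  interpret H: pair_graph H by fact
  from assms(6) obtain x y where ef: "e \<in> parcs H" "f \<in> parcs H" "\<not> same_edge e f"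
    and xy: "x \<notin> pverts H" "y \<notin> pverts H" "x \<noteq> y" and G: "G = bridge H e f x y"
    unfolding bridging_def by blast
  have "bridging_outcome H G"
  proof (cases "cycle_spread_at_least H e f (1, 2)")
    case True
    have "pair_wf_digraph G"
      unfolding G using H.pair_wf_bridge[of "fst e" "snd e" "fst f" "snd f" x y] ef xy by simp
    then show ?thesis
      using assms(6) True graph_iso_refl unfolding bridging_outcome_def by blast
  next
    case False
    from assms(7) obtain s where s: "cycle_spread H e f s"
      and ge: "(1, 1) = s \<or> ((1, 1), s) \<in> less_than <*lex*> less_than"
      unfolding cycle_spread_at_least_def by blast
    have "\<not> ((1, 2) = s \<or> ((1, 2), s) \<in> less_than <*lex*> less_than)"
      using False s unfolding cycle_spread_at_least_def by blast
    \<comment> \<open>In the lexicographic order on pairs of naturals, nothing lies strictly between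
      \<open>(1, 1)\<close> and \<open>(1, 2)\<close>.\<close>
    then have "s = (1, 1)" using ge by (cases s) auto
    with s ef(3) obtain a b c d P Q where e: "same_edge e (b, a)" and f: "same_edge f (c, d)"
      and min: "is_arg_min length (cycle_through H e f) ((b, a) # P @ (c, d) # Q)"
      and len: "(1, 1) = (length P, length Q)"
      unfolding cycle_spread_def by (auto simp del: One_nat_def)
    have u: "ucycle H ((b, a) # P @ (c, d) # Q)"
      using min by (auto simp: is_arg_min_def cycle_through_def)
    have "P = [hd P]" "Q = [hd Q]" using len by (cases P; cases Q; simp)+
    then have PQ: "P = [(a, c)]" "Q = [(d, b)]"
      using H.ucycle_Cons_ConsD[OF u] by (metis pcas.simps prod.collapse)+
    have arcs: "(b, a) \<in> parcs H" "(a, c) \<in> parcs H" "(c, d) \<in> parcs H" "(d, b) \<in> parcs H"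
      and dist: "distinct [a, c, d, b]"
      using u unfolding H.ucycle_iff PQ by auto
    \<comment> \<open>The 4-cycle \<open>b a c d\<close> is read as a ladder with rungs
      \<open>bd\<close> and \<open>ac\<close>, whose rails \<open>ba\<close> and \<open>dc\<close>
      are the bridged edges.\<close>
    define h where "h = (\<lambda>(i :: nat, s). if i = 0 then if s then d else b else if s then c else a)"
    have h: "h (0, False) = b" "h (0, True) = d" "h (1, False) = a" "h (1, True) = c"
      by (simp_all add: h_def)
    have "bridging_outcome H (bridge H (h (1 - 1, False), h (1, False)) (h (1 - 1, True), h (1, True)) x y)"
    proof (rule H.bridging_outcome_open_ladder[OF assms(2-5) xy])
      have two: "{..<1 + 1} = {0, 1 :: nat}" by auto
      show "inj_on h ({..<1 + 1} \<times> UNIV)"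
        unfolding two UNIV_bool using dist h by (auto simp: inj_on_def)
      have "open_ladder (1 + 1) =
          {((0, False), (1, False)), ((0, True), (1, True)), ((0, False), (0, True)), ((1, False), (1, True))}"
        unfolding open_ladder_def by (auto simp: less_Suc_eq)
      then show "(h u, h v) \<in> parcs H" if "(u, v) \<in> open_ladder (1 + 1)" for u v
        using that h arcs H.arcs_symmetric by auto
    qed simp
    \<comment> \<open>The cycle traverses the second edge from \<open>c\<close> to \<open>d\<close>,
      the rail from \<open>d\<close> to \<open>c\<close>; bridging does not depend on the
      direction.\<close>
    moreover have "G = bridge H (b, a) (d, c) x y"
      unfolding G using e f same_edge_swap[of f "(c, d)"] by (intro bridge_same_edge) simp_all
    ultimately show ?thesis by (simp add: h[simplified])
  qed
  then show ?thesis unfolding bridging_outcome_def .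
qed

end
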